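(* Assume that $\mathcal A$ is compact; that for each $\xi\in\Xi$, $\mathcal C(s,a,\xi)$ and $g(s,a,\xi)$ are continuous in $(s,a)$; and that there are constants $\bar{\mathcal C}_w>0$, $\kappa_w\ge0$ such that $|\mathcal C(s,a,\xi)|\le\bar{\mathcal C}_ww(s)$ and $w(g(s,a,\xi))\le\kappa_ww(s)$ for all $(s,a,\xi)\in\mathcal S\times\mathcal A\times\Xi$, with $\gamma\kappa_w<1$. Let $\bar s\in\mathcal S$. Then the set of optimal actions $$\hat{\mathcal A}_N^*(\bar s)=\arg\min_{a\in\mathcal A}\sup_{P\in\mathfrak P(\hat P_N,\hat r_N)}\mathbb E_P[\mathcal C(\bar s,a,\xi)+\gamma\hat V_N^*(g(\bar s,a,\xi))]$$ is nonempty. Moreover, for optimal actions $\hat\pi_N^*(\bar s)\in\hat{\mathcal A}_N^*(\bar s)$, the Euclidean distance from $\hat\pi_N^*(\bar s)$ to the true optimal action set $$\mathcal A^*(\bar s)=\arg\min_{a\in\mathcal A}\mathbb E_{P^c}[\mathcal C(\bar s,a,\xi)+\gamma V^*(g(\bar s,a,\xi))]$$ converges to zero almost surely as $N\to\infty$. In particular, if $\mathcal A^*(\bar s)=\{\pi^*(\bar s)\}$ is a singleton, then $\hat\pi_N^*(\bar s)$ converges to $\pi^*(\bar s)$ almost surely.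
   Context: $\mathcal S\subseteq\mathbb R^m$ and $\mathcal A\subseteq\mathbb R^n$ are nonempty closed sets; $\Xi=\{\xi^1,\dots,\xi^J\}\subseteq\mathbb R^k$ is a finite set of $J$ distinct points; $\mathscr P(\Xi)$ is the set of probability measures on $\Xi$, identified with the probability vectors $\{P=(p_j)_{j=1}^J\in[0,1]^J:\sum_{j=1}^Jp_j=1\}$ via $p_j=P(\xi=\xi^j)$. $\mathcal C:\mathcal S\times\mathcal A\times\Xi\to\mathbb R$ is the cost, $g:\mathcal S\times\mathcal A\times\Xi\to\mathcal S$ the transition function, $\gamma\in[0,1)$ the discount factor, and $P^c\in\mathscr P(\Xi)$ the true distribution. Bayesian ambiguity set: prior parameters $\tau_{j,0}>1$ are given; $\hat\xi_1,\hat\xi_2,\dots$ are i.i.d. from $P^c$ (almost sure statements refer to this sequence); $\tau_{j,N}=\tau_{j,0}+\sum_{i=1}^N\mathbf 1_{\{\hat\xi_i=\xi^j\}}$. Fix $\alpha\in(0,1)$, $\alpha'=\alpha/J$, and let $z_{1-\alpha'/2}$ be the $(1-\alpha'/2)$-quantile of the standard normal distribution. Then $$\hat p_{j,N}=\frac{\tau_{j,N}-1}{\sum_{k=1}^J\tau_{k,N}-J},\qquad \hat r_{j,N}=z_{1-\alpha'/2}\sqrt{\frac{\hat p_{j,N}(1-\hat p_{j,N})}{\sum_{k=1}^J\tau_{k,N}-J}},$$ $\hat P_N=(\hat p_{j,N})_j$, $\hat r_N=(\hat r_{j,N})_j$, and $\mathfrak P(P,r)=\{Q\in\mathscr P(\Xi):p_j-r_j\le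 q_j\le p_j+r_j,\ j=1,\dots,J\}$. Weighted norm: $w:\mathcal S\to[1,\infty)$ is a fixed continuous function, $\|V\|_w=\sup_{s\in\mathcal S}|V(s)|/w(s)$, and $\mathscr V(\mathcal S)=\{V:\mathcal S\to\mathbb R:\|V\|_w<\infty\}$. Bellman operators on $\mathscr V(\mathcal S)$: $$\mathcal L(V)(s)=\inf_{a\in\mathcal A}\mathbb E_{P^c}[\mathcal C(s,a,\xi)+\gamma V(g(s,a,\xi))],\qquad \hat{\mathcal L}_N(V)(s)=\inf_{a\in\mathcal A}\sup_{P\in\mathfrak P(\hat P_N,\hat r_N)}\mathbb E_P[\mathcal C(s,a,\xi)+\gamma V(g(s,a,\xi))].$$ Under the hypotheses of the claim these are contractions of $(\mathscr V(\mathcal S),\|\cdot\|_w)$; $V^*$ and $\hat V_N^*$ denote their unique fixed points. *)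

theory Defs
  imports "HOL-Probability.Probability"
begin

(* A probability measure on the finite support {xi j | j} is represented by its probability
   vector p, where p $ j is the mass of the point xi j. *)
definition prob_vectors :: "(real ^ 'j::finite) set" where
  "prob_vectors = {p. (\<forall>j. p $ j \<in> {0..1}) \<and> (\<Sum>j\<in>UNIV. p $ j) = 1}"

definition expect :: "('j::finite \<Rightarrow> 'x) \<Rightarrow> real ^ 'j \<Rightarrow> ('x \<Rightarrow> real) \<Rightarrow> real" where
  "expect xi p f = (\<Sum>j\<in>UNIV. p $ j * f (xi j))"

definition quantile :: "real measure \<Rightarrow> real \<Rightarrow> real" where
  "quantile D q = Inf {x. q \<le> cdf D x}"

(* The sample is indexed from 1; X 0 is never used. *)
definition iid_sample ::
  "'w measure \<Rightarrow> (nat \<Rightarrow> 'w \<Rightarrow> 'x::topological_space) \<Rightarrow> ('j::finite \<Rightarrow> 'x) \<Rightarrow> real ^ 'j \<Rightarrow> bool" where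
  "iid_sample M X xi p \<longleftrightarrow>
     prob_space.indep_vars M (\<lambda>_. borel) X {1..} \<and>
     (\<forall>i\<ge>1. \<forall>j. measure M {\<omega> \<in> space M. X i \<omega> = xi j} = p $ j)"

definition posterior_param ::
  "('j::finite \<Rightarrow> 'x) \<Rightarrow> ('j \<Rightarrow> real) \<Rightarrow> (nat \<Rightarrow> 'w \<Rightarrow> 'x) \<Rightarrow> nat \<Rightarrow> 'w \<Rightarrow> 'j \<Rightarrow> real" where
  "posterior_param xi tau0 X N \<omega> j = tau0 j + (\<Sum>i=1..N. of_bool (X i \<omega> = xi j))"

definition posterior_total ::
  "('j::finite \<Rightarrow> 'x) \<Rightarrow> ('j \<Rightarrow> real) \<Rightarrow> (nat \<Rightarrow> 'w \<Rightarrow> 'x) \<Rightarrow> nat \<Rightarrow> 'w \<Rightarrow> real" where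
  "posterior_total xi tau0 X N \<omega> =
     (\<Sum>k\<in>UNIV. posterior_param xi tau0 X N \<omega> k) - real CARD('j)"

definition p_hat ::
  "('j::finite \<Rightarrow> 'x) \<Rightarrow> ('j \<Rightarrow> real) \<Rightarrow> (nat \<Rightarrow> 'w \<Rightarrow> 'x) \<Rightarrow> nat \<Rightarrow> 'w \<Rightarrow> real ^ 'j" where
  "p_hat xi tau0 X N \<omega> =
     (\<chi> j. (posterior_param xi tau0 X N \<omega> j - 1) / posterior_total xi tau0 X N \<omega>)"

definition r_hat ::
  "('j::finite \<Rightarrow> 'x) \<Rightarrow> ('j \<Rightarrow> real) \<Rightarrow> real \<Rightarrow> (nat \<Rightarrow> 'w \<Rightarrow> 'x) \<Rightarrow> nat \<Rightarrow> 'w \<Rightarrow> real ^ 'j" where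
  "r_hat xi tau0 \<alpha> X N \<omega> =
     (\<chi> j. quantile std_normal_distribution (1 - (\<alpha> / real CARD('j)) / 2) *
           sqrt (p_hat xi tau0 X N \<omega> $ j * (1 - p_hat xi tau0 X N \<omega> $ j)
                 / posterior_total xi tau0 X N \<omega>))"

definition ambiguity_set :: "real ^ 'j::finite \<Rightarrow> real ^ 'j \<Rightarrow> (real ^ 'j) set" where
  "ambiguity_set p r = {q \<in> prob_vectors. \<forall>j. p $ j - r $ j \<le> q $ j \<and> q $ j \<le> p $ j + r $ j}"

definition bayes_ambiguity_set ::
  "('j::finite \<Rightarrow> 'x) \<Rightarrow> ('j \<Rightarrow> real) \<Rightarrow> real \<Rightarrow> (nat \<Rightarrow> 'w \<Rightarrow> 'x) \<Rightarrow> nat \<Rightarrow> 'w \<Rightarrow> (real ^ 'j) set" where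
  "bayes_ambiguity_set xi tau0 \<alpha> X N \<omega> =
     ambiguity_set (p_hat xi tau0 X N \<omega>) (r_hat xi tau0 \<alpha> X N \<omega>)"

definition weighted_norm :: "'s set \<Rightarrow> ('s \<Rightarrow> real) \<Rightarrow> ('s \<Rightarrow> real) \<Rightarrow> ereal" where
  "weighted_norm S w V = (SUP s\<in>S. ereal (\<bar>V s\<bar> / w s))"

(* Functions S -> R are represented by the functions that are undefined outside S, so that
   equality of functions is equality on S and fixed points can be unique. *)
definition value_space :: "'s set \<Rightarrow> ('s \<Rightarrow> real) \<Rightarrow> ('s \<Rightarrow> real) set" where
  "value_space S w = {V \<in> extensional S. weighted_norm S w V < \<infinity>}"

definition nominal_obj ::
  "('j::finite \<Rightarrow> 'x) \<Rightarrow> ('s \<Rightarrow> 'a \<Rightarrow> 'x \<Rightarrow> real) \<Rightarrow> ('s \<Rightarrow> 'a \<Rightarrow> 'x \<Rightarrow> 's) \<Rightarrow> real \<Rightarrow> real ^ 'j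
     \<Rightarrow> ('s \<Rightarrow> real) \<Rightarrow> 's \<Rightarrow> 'a \<Rightarrow> real" where
  "nominal_obj xi C g \<gamma> p V s a = expect xi p (\<lambda>x. C s a x + \<gamma> * V (g s a x))"

definition robust_obj ::
  "('j::finite \<Rightarrow> 'x) \<Rightarrow> ('s \<Rightarrow> 'a \<Rightarrow> 'x \<Rightarrow> real) \<Rightarrow> ('s \<Rightarrow> 'a \<Rightarrow> 'x \<Rightarrow> 's) \<Rightarrow> real \<Rightarrow> (real ^ 'j) set
     \<Rightarrow> ('s \<Rightarrow> real) \<Rightarrow> 's \<Rightarrow> 'a \<Rightarrow> real" where
  "robust_obj xi C g \<gamma> Q V s a = (SUP p\<in>Q. expect xi p (\<lambda>x. C s a x + \<gamma> * V (g s a x)))"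

(* In the following three definitions, F V s a is the objective at state s and action a with
   continuation value V (nominal_obj or robust_obj). *)
definition bellman ::
  "'s set \<Rightarrow> 'a set \<Rightarrow> (('s \<Rightarrow> real) \<Rightarrow> 's \<Rightarrow> 'a \<Rightarrow> real) \<Rightarrow> ('s \<Rightarrow> real) \<Rightarrow> 's \<Rightarrow> real" where
  "bellman S A F V = (\<lambda>s\<in>S. INF a\<in>A. F V s a)"

definition value_fun ::
  "'s set \<Rightarrow> 'a set \<Rightarrow> ('s \<Rightarrow> real) \<Rightarrow> (('s \<Rightarrow> real) \<Rightarrow> 's \<Rightarrow> 'a \<Rightarrow> real) \<Rightarrow> 's \<Rightarrow> real" where
  "value_fun S A w F = (THE V. V \<in> value_space S w \<and> bellman S A F V = V)"

definition optimal_actions ::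
  "'s set \<Rightarrow> 'a set \<Rightarrow> ('s \<Rightarrow> real) \<Rightarrow> (('s \<Rightarrow> real) \<Rightarrow> 's \<Rightarrow> 'a \<Rightarrow> real) \<Rightarrow> 's \<Rightarrow> 'a set" where
  "optimal_actions S A w F s = {a. is_arg_min (F (value_fun S A w F) s) (\<lambda>b. b \<in> A) a}"

definition true_optimal_actions ::
  "'s set \<Rightarrow> 'a set \<Rightarrow> ('s \<Rightarrow> real) \<Rightarrow> ('j::finite \<Rightarrow> 'x) \<Rightarrow> ('s \<Rightarrow> 'a \<Rightarrow> 'x \<Rightarrow> real)
     \<Rightarrow> ('s \<Rightarrow> 'a \<Rightarrow> 'x \<Rightarrow> 's) \<Rightarrow> real \<Rightarrow> real ^ 'j \<Rightarrow> 's \<Rightarrow> 'a set" where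
  "true_optimal_actions S A w xi C g \<gamma> Pc = optimal_actions S A w (nominal_obj xi C g \<gamma> Pc)"

definition bayes_optimal_actions ::
  "'s set \<Rightarrow> 'a set \<Rightarrow> ('s \<Rightarrow> real) \<Rightarrow> ('j::finite \<Rightarrow> 'x) \<Rightarrow> ('s \<Rightarrow> 'a \<Rightarrow> 'x \<Rightarrow> real)
     \<Rightarrow> ('s \<Rightarrow> 'a \<Rightarrow> 'x \<Rightarrow> 's) \<Rightarrow> real \<Rightarrow> ('j \<Rightarrow> real) \<Rightarrow> real \<Rightarrow> (nat \<Rightarrow> 'w \<Rightarrow> 'x) \<Rightarrow> nat \<Rightarrow> 'w
     \<Rightarrow> 's \<Rightarrow> 'a set" where
  "bayes_optimal_actions S A w xi C g \<gamma> tau0 \<alpha> X N \<omega> =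
     optimal_actions S A w (robust_obj xi C g \<gamma> (bayes_ambiguity_set xi tau0 \<alpha> X N \<omega>))"

end

theory Submission
  imports Defs
begin

text \<open>The nominal problem is the robust problem with ambiguity set \<open>{P\<^sup>c}\<close>. For any nonempty set
  of probability vectors the Bellman operator contracts the weighted norm with factor \<open>\<gamma>\<kappa>\<close> and
  preserves continuity, so its fixed point is continuous and the optimal actions exist. If all vectors
  of the ambiguity set are within \<open>\<epsilon>\<close> of \<open>P\<^sup>c\<close> in the 1-norm, the robust objective differs from the
  nominal one by \<open>O(\<epsilon>)\<close>, uniformly in the action, and minimizers over a compact set are
  stable under uniform convergence. The law of large numbers shrinks the Bayesian ambiguity sets to \<open>P\<^sup>c\<close>.\<close>

subsection \<open>The Bayesian ambiguity sets\<close>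

lemma cdf_std_normal_le_half:
  assumes "x < 0"
  shows "cdf std_normal_distribution x \<le> 1 / 2"
proof -
  interpret real_distribution std_normal_distribution
    by (rule real_dist_normal_dist)
  have "emeasure std_normal_distribution {..x} = emeasure std_normal_distribution {-x..}"
  proof -
    have "emeasure std_normal_distribution {..x}
        = (\<integral>\<^sup>+y. ennreal (std_normal_density y) * indicator {..x} y \<partial>lborel)"
      by (simp add: emeasure_density)
    also have "\<dots> = (\<integral>\<^sup>+y. ennreal (std_normal_density (- y)) * indicator {..x} (- y) \<partial>lborel)"
      by (subst nn_integral_real_affine[where c = "-1" and t = 0]) auto
    also have "\<dots> = (\<integral>\<^sup>+y. ennreal (std_normal_density y) * indicator {-x..} y \<partial>lborel)"
      by (intro nn_integral_cong)
        (auto simp: std_normal_density_def indicator_def)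
    also have "\<dots> = emeasure std_normal_distribution {-x..}"
      by (simp add: emeasure_density)
    finally show ?thesis .
  qed
  then have eq: "prob {..x} = prob {-x..}"
    by (simp add: measure_def)
  \<comment> \<open>The two tails have equal mass by symmetry of the density and are disjoint
    because \<open>x\<close> is negative.\<close>
  have "prob {..x} + prob {-x..} = prob ({..x} \<union> {-x..})"
    using assms by (intro finite_measure_Union[symmetric]) auto
  also have "\<dots> \<le> 1"
    by simp
  finally show ?thesis
    using eq by (simp add: cdf_def2)
qed

text \<open>Levels above 1/2 exclude every negative point from the set whose infimum is taken, and
  \<open>q < 1\<close> makes that set nonempty, so that \<open>Inf\<close> is a genuine infimum.
  This sign makes the radii \<open>r_hat\<close> nonnegative.\<close>

lemma quantile_std_normal_nonneg:
  assumes "1 / 2 < q" "q < 1"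
  shows "0 \<le> quantile std_normal_distribution q"
  unfolding quantile_def
proof (rule cInf_greatest)
  interpret real_distribution std_normal_distribution
    by (rule real_dist_normal_dist)
  have "\<forall>\<^sub>F x in at_top. q < cdf std_normal_distribution x"
    using cdf_lim_at_top_prob assms(2) by (rule order_tendstoD)
  then obtain x where "q < cdf std_normal_distribution x"
    using eventually_happens' trivial_limit_at_top_linorder by blast
  then show "{x. q \<le> cdf std_normal_distribution x} \<noteq> {}"
    using less_imp_le by blast
  fix x assume "x \<in> {x. q \<le> cdf std_normal_distribution x}"
  then show "0 \<le> x"
    using cdf_std_normal_le_half[of x] assms(1) by force
qed

text \<open>The deviations from the mean have summable probabilities by Hoeffding's inequality, so the
  Borel--Cantelli lemma gives the strong law for indicators.\<close>
lemma (in prob_space) AE_empirical_frequency_tendsto: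
  fixes X :: "nat \<Rightarrow> 'a \<Rightarrow> 'x::t1_space"
  assumes indep: "indep_vars (\<lambda>_. borel) X {1..}"
    and p: "\<And>i. i \<ge> 1 \<Longrightarrow> prob {\<omega> \<in> space M. X i \<omega> = x} = p"
  shows "AE \<omega> in M. (\<lambda>N. (\<Sum>i=1..N. of_bool (X i \<omega> = x)) / real N) \<longlonglongrightarrow> p"
proof -
  define Y :: "nat \<Rightarrow> 'a \<Rightarrow> real" where "Y = (\<lambda>i \<omega>. of_bool (X i \<omega> = x))"
  have meas: "(\<lambda>y. of_bool (y = x) :: real) \<in> borel_measurable borel"
  proof -
    have "(\<lambda>y. of_bool (y = x) :: real) = indicator {x}"
      by (auto simp: fun_eq_iff indicator_def)
    then show ?thesis by simp
  qed
  have indepY: "indep_vars (\<lambda>_. borel) Y {1..}"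
    unfolding Y_def by (rule indep_vars_compose2[OF indep meas])
  have rvX: "random_variable borel (X i)" if "i \<ge> 1" for i
    using indep that by (auto simp: indep_vars_def)
  have rvY: "random_variable borel (Y i)" if "i \<ge> 1" for i
    using indepY that by (auto simp: indep_vars_def)
  have EY: "expectation (Y i) = p" if "i \<ge> 1" for i
  proof -
    have "{\<omega> \<in> space M. X i \<omega> = x} \<in> events"
      using measurable_sets[OF rvX[OF that], of "{x}"] by (simp add: vimage_def Int_def conj_commute)
    moreover have "expectation (Y i) = expectation (indicator {\<omega> \<in> space M. X i \<omega> = x})"
      by (intro Bochner_Integration.integral_cong) (auto simp: Y_def indicator_def)
    ultimately show ?thesis
      using p[OF that] by simp
  qed
  define bad where
    "bad e N = {\<omega> \<in> space M. real N * e \<le> \<bar>(\<Sum>i\<in>{1..N}. Y i \<omega>) - real N * p\<bar>}" for e :: real and N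
  have meas_bad: "bad e N \<in> events" for e N
  proof -
    have [measurable]: "random_variable borel (\<lambda>\<omega>. \<Sum>i\<in>{1..N}. Y i \<omega>)"
      by (intro borel_measurable_sum) (auto intro: rvY)
    show ?thesis unfolding bad_def by measurable
  qed
  \<comment> \<open>For summands in [0,1] and a deviation \<open>N * e\<close>, the Hoeffding
    exponent is -2 (N e)^2 / N, which is linear in \<open>N\<close>; the bound is therefore
    geometric. At \<open>N = 0\<close> the bound is 2 and holds trivially.\<close>
  have prob_bad: "prob (bad e N) \<le> 2 * exp (- 2 * e\<^sup>2) ^ N" if "e > 0" for e N
  proof (cases "N = 0")
    case True
    then show ?thesis by (simp add: order_trans[OF prob_le_1])
  next
    case False
    interpret Hoeffding_ineq M "{1..N}" Y "\<lambda>_. 0" "\<lambda>_. 1" "real N * p"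
    proof unfold_locales
      show "indep_vars (\<lambda>_. borel) Y {1..N}"
        by (rule indep_vars_subset[OF indepY]) auto
      show "real N * p \<equiv> \<Sum>i\<in>{1..N}. expectation (Y i)"
        by (rule eq_reflection) (simp add: EY)
    qed (auto simp: Y_def)
    have "prob (bad e N) \<le> 2 * exp (- 2 * (real N * e)\<^sup>2 / (\<Sum>i\<in>{1..N}. (1 - 0)\<^sup>2))"
      unfolding bad_def using that False by (intro Hoeffding_ineq_abs_ge) auto
    also have "- 2 * (real N * e)\<^sup>2 / (\<Sum>i\<in>{1..N}. (1 - 0)\<^sup>2) = real N * (- 2 * e\<^sup>2)"
      using False by (simp add: power2_eq_square)
    also have "exp \<dots> = exp (- 2 * e\<^sup>2) ^ N"
      by (rule exp_of_nat_mult)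
    finally show ?thesis .
  qed
  have "AE \<omega> in M. \<forall>\<^sub>F N in sequentially. \<omega> \<in> space M - bad e N" if "e > 0" for e
  proof (rule borel_cantelli_AE1)
    show "summable (\<lambda>N. prob (bad e N))"
    proof (rule summable_comparison_test')
      show "summable (\<lambda>N. 2 * exp (- 2 * e\<^sup>2) ^ N)"
        using that by (intro summable_mult summable_geometric) auto
      show "norm (prob (bad e N)) \<le> 2 * exp (- 2 * e\<^sup>2) ^ N" for N
        using prob_bad[OF that] by simp
    qed
  qed (auto simp: meas_bad emeasure_eq_measure)
  \<comment> \<open>Restricting to the countably many tolerances 1/(k+1) allows the exceptional null
    sets to be united.\<close>
  then have "AE \<omega> in M. \<forall>k. \<forall>\<^sub>F N in sequentially. \<omega> \<in> space M - bad (inverse (real (Suc k))) N"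
    by (subst AE_all_countable) auto
  then show ?thesis
  proof eventually_elim
    case (elim \<omega>)
    show ?case
    proof (rule tendstoI)
      fix e :: real assume "e > 0"
      then obtain k where k: "inverse (real (Suc k)) < e"
        using reals_Archimedean by blast
      from elim[rule_format, of k] eventually_gt_at_top[of 0]
      show "\<forall>\<^sub>F N in sequentially. dist ((\<Sum>i=1..N. of_bool (X i \<omega> = x)) / real N) p < e"
      proof eventually_elim
        case (elim N)
        have "\<bar>(\<Sum>i\<in>{1..N}. Y i \<omega>) - real N * p\<bar> < real N * inverse (real (Suc k))"
          using elim by (auto simp: bad_def)
        also have "\<dots> < real N * e"
          using k elim by (intro mult_strict_left_mono) auto
        finally have "\<bar>(\<Sum>i\<in>{1..N}. Y i \<omega>) - real N * p\<bar> / real N < e"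
          using elim by (simp add: divide_less_eq mult.commute)
        moreover have "(\<Sum>i\<in>{1..N}. Y i \<omega>) / real N - p = ((\<Sum>i\<in>{1..N}. Y i \<omega>) - real N * p) / real N"
          using elim by (simp add: field_simps)
        ultimately show ?case
          by (simp add: dist_real_def Y_def)
      qed
    qed
  qed
qed

section \<open>Posterior point estimates, radii and their limits\<close>

lemma posterior_total_eq:
  "posterior_total xi tau0 X N \<omega> = (\<Sum>j\<in>UNIV. posterior_param xi tau0 X N \<omega> j - 1)"
  by (simp add: posterior_total_def sum_subtractf)

text \<open>The numerators are positive, since each prior parameter exceeds 1 and counts are
  nonnegative, and the denominator is their sum. Hence \<open>p_hat\<close> is a normalized positive
  vector.\<close>

lemma p_hat_mem_prob_vectors:
  fixes xi :: "'j::finite \<Rightarrow> 'x"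
  assumes "\<And>j. tau0 j > 1"
  shows "p_hat xi tau0 X N \<omega> \<in> prob_vectors" "0 < posterior_total xi tau0 X N \<omega>"
proof -
  let ?c = "\<lambda>j. posterior_param xi tau0 X N \<omega> j - 1"
  have pos: "0 < ?c j" for j
    using assms[of j] by (simp add: posterior_param_def add_pos_nonneg sum_nonneg add_increasing2 less_le_trans)
  show tot: "0 < posterior_total xi tau0 X N \<omega>"
    unfolding posterior_total_eq using pos by (intro sum_pos) auto
  have "?c j \<le> posterior_total xi tau0 X N \<omega>" for j
    unfolding posterior_total_eq using pos
    by (intro member_le_sum) (auto intro: less_imp_le)
  moreover have "(\<Sum>j\<in>UNIV. ?c j / posterior_total xi tau0 X N \<omega>) = 1"
    unfolding sum_divide_distrib[symmetric] posterior_total_eq[symmetric] using tot by simp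
  ultimately show "p_hat xi tau0 X N \<omega> \<in> prob_vectors"
    using tot pos by (auto simp: prob_vectors_def p_hat_def less_imp_le)
qed

text \<open>The center \<open>p_hat\<close> belongs to its own ambiguity set as soon as the radii
  are nonnegative; \<open>\<alpha> < CARD('j)\<close> puts the quantile level above 1/2.\<close>

lemma bayes_ambiguity_set_nonempty:
  fixes xi :: "'j::finite \<Rightarrow> 'x"
  assumes tau0: "\<And>j. tau0 j > 1" and alpha: "0 < \<alpha>" "\<alpha> < 1"
  shows "bayes_ambiguity_set xi tau0 \<alpha> X N \<omega> \<noteq> {}"
proof -
  let ?p = "p_hat xi tau0 X N \<omega>"
  have "1 \<le> real CARD('j)"
    by (simp add: Suc_leI)
  then have "\<alpha> < real CARD('j)"
    using alpha by linarith
  then have "0 \<le> quantile std_normal_distribution (1 - (\<alpha> / real CARD('j)) / 2)"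
    using alpha by (intro quantile_std_normal_nonneg) auto
  then have "0 \<le> r_hat xi tau0 \<alpha> X N \<omega> $ j" for j
    using p_hat_mem_prob_vectors[of tau0 xi X N \<omega>, OF tau0]
    by (auto simp: r_hat_def prob_vectors_def less_imp_le)
  then have "?p \<in> bayes_ambiguity_set xi tau0 \<alpha> X N \<omega>"
    using p_hat_mem_prob_vectors[of tau0 xi X N \<omega>, OF tau0]
    by (auto simp: bayes_ambiguity_set_def ambiguity_set_def)
  then show ?thesis by blast
qed

text \<open>A statement about one sample path. After division by \<open>N\<close> the prior
  contribution vanishes, so the numerators tend to the frequencies and the denominator to their sum
  1. The radii vanish because the variance terms converge while the denominator diverges.\<close>

lemma posterior_tendsto:
  fixes xi :: "'j::finite \<Rightarrow> 'x"
  assumes freq: "\<And>j. (\<lambda>N. (\<Sum>i=1..N. of_bool (X i \<omega> = xi j)) / real N) \<longlonglongrightarrow> p $ j"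
    and p: "(\<Sum>j\<in>UNIV. p $ j) = 1"
  shows p_hat_tendsto: "(\<lambda>N. p_hat xi tau0 X N \<omega> $ j) \<longlonglongrightarrow> p $ j"
    and r_hat_tendsto: "(\<lambda>N. r_hat xi tau0 \<alpha> X N \<omega> $ j) \<longlonglongrightarrow> 0"
proof -
  define c where "c N j = posterior_param xi tau0 X N \<omega> j - 1" for N j
  define T where "T N = posterior_total xi tau0 X N \<omega>" for N
  have c: "(\<lambda>N. c N j / real N) \<longlonglongrightarrow> p $ j" for j
  proof -
    have "(\<lambda>N. (tau0 j - 1) / real N + (\<Sum>i=1..N. of_bool (X i \<omega> = xi j)) / real N) \<longlonglongrightarrow> 0 + p $ j"
      by (intro tendsto_add freq lim_const_over_n)
    then show ?thesis
      by (simp add: c_def posterior_param_def add_divide_distrib diff_divide_distrib algebra_simps)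
  qed
  have "(\<lambda>N. \<Sum>j\<in>UNIV. c N j / real N) \<longlonglongrightarrow> (\<Sum>j\<in>UNIV. p $ j)"
    by (intro tendsto_sum c)
  then have T: "(\<lambda>N. T N / real N) \<longlonglongrightarrow> 1"
    by (simp add: p T_def c_def posterior_total_eq sum_divide_distrib)
  have ph: "(\<lambda>N. p_hat xi tau0 X N \<omega> $ j) \<longlonglongrightarrow> p $ j" for j
  proof -
    have "(\<lambda>N. (c N j / real N) / (T N / real N)) \<longlonglongrightarrow> p $ j / 1"
      by (intro tendsto_divide c T) simp
    moreover have "\<forall>\<^sub>F N in sequentially. (c N j / real N) / (T N / real N) = p_hat xi tau0 X N \<omega> $ j"
      using eventually_gt_at_top[of 0]
      by eventually_elim (simp add: p_hat_def c_def T_def)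
    ultimately show ?thesis
      by (simp add: filterlim_cong)
  qed
  then show "(\<lambda>N. p_hat xi tau0 X N \<omega> $ j) \<longlonglongrightarrow> p $ j" .
  \<comment> \<open>\<open>T N\<close> grows like \<open>N\<close>, because \<open>T N / N\<close>
    tends to 1.\<close>
  have "filterlim (\<lambda>N. T N / real N * real N) at_top sequentially"
    by (rule filterlim_tendsto_pos_mult_at_top[OF T]) (auto intro: filterlim_real_sequentially)
  moreover have "\<forall>\<^sub>F N in sequentially. T N / real N * real N = T N"
    using eventually_gt_at_top[of 0] by eventually_elim simp
  ultimately have "filterlim T at_top sequentially"
    by (simp add: filterlim_cong)
  then have "(\<lambda>N. p_hat xi tau0 X N \<omega> $ j * (1 - p_hat xi tau0 X N \<omega> $ j) / T N) \<longlonglongrightarrow> 0"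
    by (intro real_tendsto_divide_at_top[where c = "p $ j * (1 - p $ j)"] tendsto_intros ph)
  then have "(\<lambda>N. quantile std_normal_distribution (1 - (\<alpha> / real CARD('j)) / 2) *
      sqrt (p_hat xi tau0 X N \<omega> $ j * (1 - p_hat xi tau0 X N \<omega> $ j) / T N)) \<longlonglongrightarrow>
      quantile std_normal_distribution (1 - (\<alpha> / real CARD('j)) / 2) * sqrt 0"
    by (intro tendsto_mult tendsto_const tendsto_real_sqrt)
  then show "(\<lambda>N. r_hat xi tau0 \<alpha> X N \<omega> $ j) \<longlonglongrightarrow> 0"
    by (simp add: r_hat_def T_def)
qed

subsection \<open>Robust control with a weighted norm\<close>

lemma abs_cSUP_diff_le:
  fixes f h :: "'a \<Rightarrow> real"
  assumes "Q \<noteq> {}" "bdd_above (f ` Q)" "bdd_above (h ` Q)" "\<And>x. x \<in> Q \<Longrightarrow> \<bar>f x - h x\<bar> \<le> c"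
  shows "\<bar>(SUP x\<in>Q. f x) - (SUP x\<in>Q. h x)\<bar> \<le> c"
proof -
  have "f x \<le> (SUP x\<in>Q. h x) + c" "h x \<le> (SUP x\<in>Q. f x) + c" if "x \<in> Q" for x
    using cSUP_upper[OF that assms(2)] cSUP_upper[OF that assms(3)] assms(4)[OF that] by linarith+
  then have "(SUP x\<in>Q. f x) \<le> (SUP x\<in>Q. h x) + c" "(SUP x\<in>Q. h x) \<le> (SUP x\<in>Q. f x) + c"
    using assms(1) by (auto intro: cSUP_least)
  then show ?thesis by linarith
qed

lemma abs_cINF_diff_le:
  fixes f h :: "'a \<Rightarrow> real"
  assumes "Q \<noteq> {}" "bdd_below (f ` Q)" "bdd_below (h ` Q)" "\<And>x. x \<in> Q \<Longrightarrow> \<bar>f x - h x\<bar> \<le> c"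
  shows "\<bar>(INF x\<in>Q. f x) - (INF x\<in>Q. h x)\<bar> \<le> c"
proof -
  have "(INF x\<in>Q. h x) - c \<le> f x" "(INF x\<in>Q. f x) - c \<le> h x" if "x \<in> Q" for x
    using cINF_lower[OF assms(2) that] cINF_lower[OF assms(3) that] assms(4)[OF that] by linarith+
  then have "(INF x\<in>Q. h x) - c \<le> (INF x\<in>Q. f x)" "(INF x\<in>Q. f x) - c \<le> (INF x\<in>Q. h x)"
    using assms(1) by (auto intro: cINF_greatest)
  then show ?thesis by linarith
qed

text \<open>Compactness of \<open>A\<close> makes joint continuity uniform in the action near a
  fixed state, and infima of uniformly close functions are close. The margin \<open>e / 2\<close> is
  there because passing to infima only keeps a weak inequality.\<close>

lemma continuous_on_INF_compact:
  fixes F :: "'s::topological_space \<Rightarrow> 'a::topological_space \<Rightarrow> real"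
  assumes cont: "continuous_on (S \<times> A) (\<lambda>(s, a). F s a)" and A: "compact A" "A \<noteq> {}"
    and bdd: "\<And>s. s \<in> S \<Longrightarrow> bdd_below (F s ` A)"
  shows "continuous_on S (\<lambda>s. INF a\<in>A. F s a)"
  unfolding continuous_on_def
proof (intro ballI tendstoI)
  fix s0 and e :: real assume s0: "s0 \<in> S" and e: "0 < e"
  obtain U where U: "s0 \<in> U" "open U"
    and le: "\<forall>s\<in>U \<inter> S. \<forall>a\<in>A. dist (F s a) (F s0 a) \<le> e / 2"
    using continuous_on_prod_compactE[OF cont A(1) s0, of "e / 2"] e by auto
  have close: "\<bar>(INF a\<in>A. F s a) - (INF a\<in>A. F s0 a)\<bar> \<le> e / 2" if "s \<in> U" "s \<in> S" for s
    using that le by (intro abs_cINF_diff_le bdd A(2) s0) (auto simp: dist_real_def)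
  have "\<forall>\<^sub>F s in at s0 within S. s \<in> U \<inter> S"
    using U by (auto simp: eventually_at_topological)
  then show "\<forall>\<^sub>F s in at s0 within S. dist (INF a\<in>A. F s a) (INF a\<in>A. F s0 a) < e"
  proof eventually_elim
    case (elim s)
    then show ?case
      using close[of s] e by (simp add: dist_real_def)
  qed
qed

lemma argmin_nonempty:
  fixes f :: "'a::topological_space \<Rightarrow> real"
  assumes "compact A" "A \<noteq> {}" "continuous_on A f"
  shows "{a. is_arg_min f (\<lambda>b. b \<in> A) a} \<noteq> {}"
  using continuous_attains_inf[OF assms] by (auto simp: is_arg_min_linorder)

text \<open>Actions at distance at least \<open>r\<close> from the minimizers form a compact set, on
  which \<open>f\<close> exceeds its minimum by some gap \<open>d > 0\<close>. Each
  \<open>x n\<close> minimizes \<open>f\<close> up to \<open>2 * e n\<close>, hence leaves that set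
  once \<open>e n < d / 2\<close>.\<close>

lemma infdist_argmin_tendsto:
  fixes f :: "'a::metric_space \<Rightarrow> real"
  assumes A: "compact A" and f: "continuous_on A f"
    and close: "\<And>n a. a \<in> A \<Longrightarrow> \<bar>h n a - f a\<bar> \<le> e n" and e: "e \<longlonglongrightarrow> 0"
    and x: "\<And>n::nat. is_arg_min (h n) (\<lambda>a. a \<in> A) (x n)"
  shows "(\<lambda>n. infdist (x n) {a. is_arg_min f (\<lambda>a. a \<in> A) a}) \<longlonglongrightarrow> 0"
proof -
  let ?M = "{a. is_arg_min f (\<lambda>a. a \<in> A) a}"
  have xA: "x n \<in> A" and xmin: "a \<in> A \<Longrightarrow> h n (x n) \<le> h n a" for n a
    using x[of n] by (auto simp: is_arg_min_linorder)
  then obtain m where m: "m \<in> ?M"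
    using argmin_nonempty[OF A _ f] by blast
  \<comment> \<open>Going from \<open>f\<close> to \<open>h n\<close> at \<open>x n\<close> and back
    to \<open>f\<close> at \<open>m\<close> costs \<open>e n\<close> each time.\<close>
  have fx: "f (x n) \<le> f m + 2 * e n" for n
    using close[OF xA, of n n] close[of m n] xmin[of m n] m by (auto simp: is_arg_min_linorder)
  show ?thesis
  proof (rule tendstoI)
    fix r :: real assume r: "0 < r"
    define K where "K = {a \<in> A. r \<le> infdist a ?M}"
    have "compact K"
    proof -
      have "closed {a. r \<le> infdist a ?M}"
        by (intro closed_Collect_le continuous_intros)
      then have "compact (A \<inter> {a. r \<le> infdist a ?M})"
        by (rule compact_Int_closed[OF A])
      then show ?thesis by (simp add: K_def Int_def)
    qed
    obtain d where d: "0 < d" "\<And>a. a \<in> K \<Longrightarrow> f m + d \<le> f a"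
    proof (cases "K = {}")
      case True
      then show ?thesis using that[of 1] by simp
    next
      case False
      have "continuous_on K f"
        using f by (rule continuous_on_subset) (auto simp: K_def)
      from continuous_attains_inf[OF \<open>compact K\<close> False this]
      obtain k where k: "k \<in> K" "\<And>a. a \<in> K \<Longrightarrow> f k \<le> f a" by blast
      have "k \<notin> ?M"
        using k(1) r by (auto simp: K_def)
      then have "f m < f k"
        using k(1) m by (force simp: K_def is_arg_min_linorder)
      with k(2) that[of "f k - f m"] show ?thesis by auto
    qed
    have "\<forall>\<^sub>F n in sequentially. e n < d / 2"
      using e d(1) by (intro order_tendstoD) auto
    then show "\<forall>\<^sub>F n in sequentially. dist (infdist (x n) ?M) 0 < r"
    proof eventually_elim
      case (elim n)
      then have "x n \<notin> K"
        using d(2)[of "x n"] fx[of n] by auto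
      then show ?case
        using xA by (auto simp: K_def infdist_nonneg)
    qed
  qed
qed

section \<open>Expectations under probability vectors and the robust objective\<close>

lemma abs_expect_le:
  assumes "p \<in> prob_vectors" "\<And>j. \<bar>f (xi j)\<bar> \<le> c"
  shows "\<bar>expect xi p f\<bar> \<le> c"
proof -
  have "\<bar>expect xi p f\<bar> \<le> (\<Sum>j\<in>UNIV. \<bar>p $ j * f (xi j)\<bar>)"
    unfolding expect_def by (rule sum_abs)
  also have "\<dots> \<le> (\<Sum>j\<in>UNIV. p $ j * c)"
    using assms by (intro sum_mono) (auto simp: prob_vectors_def abs_mult intro!: mult_left_mono)
  also have "\<dots> = c"
    using assms(1) by (simp add: prob_vectors_def flip: sum_distrib_right)
  finally show ?thesis .
qed

lemma expect_diff: "expect xi p f - expect xi p h = expect xi p (\<lambda>x. f x - h x)"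
  by (simp add: expect_def sum_subtractf algebra_simps)

text \<open>Over the reals \<open>SUP\<close> is the true supremum only of nonempty sets that are
  bounded above; this supplies the bound for every comparison of robust objectives.\<close>

lemma bdd_above_expect:
  assumes "Q \<subseteq> prob_vectors"
  shows "bdd_above ((\<lambda>p. expect xi p f) ` Q)"
proof (rule bdd_aboveI2)
  fix p assume "p \<in> Q"
  then have "\<bar>expect xi p f\<bar> \<le> (\<Sum>j\<in>UNIV. \<bar>f (xi j)\<bar>)"
    using assms by (intro abs_expect_le) (auto intro: member_le_sum)
  then show "expect xi p f \<le> (\<Sum>j\<in>UNIV. \<bar>f (xi j)\<bar>)" by simp
qed

text \<open>Neither averaging with a probability vector nor taking suprema enlarges a uniform bound.
  States, actions and value functions all vary so that one estimate yields both contraction (equal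
  states and actions) and continuity (equal value functions).\<close>

lemma abs_robust_obj_diff_le:
  assumes Q: "Q \<noteq> {}" "Q \<subseteq> prob_vectors"
    and le: "\<And>j. \<bar>(C s a (xi j) + \<gamma> * V (g s a (xi j))) - (C s' a' (xi j) + \<gamma> * W (g s' a' (xi j)))\<bar> \<le> c"
  shows "\<bar>robust_obj xi C g \<gamma> Q V s a - robust_obj xi C g \<gamma> Q W s' a'\<bar> \<le> c"
  unfolding robust_obj_def
proof (intro abs_cSUP_diff_le bdd_above_expect Q)
  fix p assume "p \<in> Q"
  then show "\<bar>expect xi p (\<lambda>x. C s a x + \<gamma> * V (g s a x)) -
              expect xi p (\<lambda>x. C s' a' x + \<gamma> * W (g s' a' x))\<bar> \<le> c"
    unfolding expect_diff using Q le by (intro abs_expect_le) auto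
qed

lemma nominal_obj_eq_robust_obj: "nominal_obj xi C g \<gamma> p = robust_obj xi C g \<gamma> {p}"
  by (simp add: fun_eq_iff nominal_obj_def robust_obj_def)

text \<open>Trades the extended-real norm for an explicit constant \<open>K\<close>, the form in
  which all later estimates are made.\<close>

lemma value_space_iff:
  assumes "S \<noteq> {}" "\<And>s. s \<in> S \<Longrightarrow> 1 \<le> w s"
  shows "V \<in> value_space S w \<longleftrightarrow> V \<in> extensional S \<and> (\<exists>K. \<forall>s\<in>S. \<bar>V s\<bar> \<le> K * w s)"
proof -
  have pos: "0 < w s" if "s \<in> S" for s
    using assms(2)[OF that] by simp
  have "weighted_norm S w V < \<infinity> \<longleftrightarrow> (\<exists>K. \<forall>s\<in>S. \<bar>V s\<bar> / w s \<le> K)"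
  proof
    assume lt: "weighted_norm S w V < \<infinity>"
    \<comment> \<open>A point of \<open>S\<close> keeps the norm from being minus infinity, so that
      a norm below infinity is a real number.\<close>
    obtain s where s: "s \<in> S" using assms(1) by blast
    have "ereal 0 \<le> ereal (\<bar>V s\<bar> / w s)"
      using pos[OF s] by simp
    also have "\<dots> \<le> weighted_norm S w V"
      unfolding weighted_norm_def using s by (rule SUP_upper)
    finally obtain K where K: "weighted_norm S w V = ereal K"
      using lt by (cases "weighted_norm S w V") auto
    have "\<bar>V s\<bar> / w s \<le> K" if "s \<in> S" for s
      using SUP_upper[OF that, of "\<lambda>s. ereal (\<bar>V s\<bar> / w s)"] K by (simp add: weighted_norm_def)
    then show "\<exists>K. \<forall>s\<in>S. \<bar>V s\<bar> / w s \<le> K" by blast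
  next
    assume "\<exists>K. \<forall>s\<in>S. \<bar>V s\<bar> / w s \<le> K"
    then obtain K where "\<And>s. s \<in> S \<Longrightarrow> \<bar>V s\<bar> / w s \<le> K" by blast
    then have "weighted_norm S w V \<le> ereal K"
      unfolding weighted_norm_def by (intro SUP_least) auto
    then show "weighted_norm S w V < \<infinity>"
      by (metis ereal_infty_less_eq(1) ereal.simps(2) less_ereal.simps(4) order_le_less_trans)
  qed
  also have "\<dots> \<longleftrightarrow> (\<exists>K. \<forall>s\<in>S. \<bar>V s\<bar> \<le> K * w s)"
    using pos by (simp add: pos_divide_le_eq cong: ball_cong)
  finally show ?thesis
    by (simp add: value_space_def)
qed

section \<open>Control problems with weighted bounds\<close>

locale weighted_control =
  fixes S :: "'s::metric_space set" and A :: "'a::metric_space set"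
    and xi :: "'j::finite \<Rightarrow> 'x"
    and C :: "'s \<Rightarrow> 'a \<Rightarrow> 'x \<Rightarrow> real" and g :: "'s \<Rightarrow> 'a \<Rightarrow> 'x \<Rightarrow> 's"
    and \<gamma> :: real and w :: "'s \<Rightarrow> real" and B \<kappa> :: real
  assumes S_nonempty: "S \<noteq> {}"
    and A_compact: "compact A" and A_nonempty: "A \<noteq> {}"
    and g_mem: "\<And>s a j. s \<in> S \<Longrightarrow> a \<in> A \<Longrightarrow> g s a (xi j) \<in> S"
    and gamma_nonneg: "0 \<le> \<gamma>" and kappa_nonneg: "0 \<le> \<kappa>" and B_nonneg: "0 \<le> B"
    and contraction: "\<gamma> * \<kappa> < 1"
    and w_cont: "continuous_on S w" and w_ge_1: "\<And>s. s \<in> S \<Longrightarrow> 1 \<le> w s"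
    and C_cont: "\<And>j. continuous_on (S \<times> A) (\<lambda>(s, a). C s a (xi j))"
    and g_cont: "\<And>j. continuous_on (S \<times> A) (\<lambda>(s, a). g s a (xi j))"
    and C_bound: "\<And>s a j. s \<in> S \<Longrightarrow> a \<in> A \<Longrightarrow> \<bar>C s a (xi j)\<bar> \<le> B * w s"
    and g_bound: "\<And>s a j. s \<in> S \<Longrightarrow> a \<in> A \<Longrightarrow> w (g s a (xi j)) \<le> \<kappa> * w s"
begin

abbreviation "obj \<equiv> robust_obj xi C g \<gamma>"
abbreviation "val Q \<equiv> value_fun S A w (obj Q)"

lemma w_pos: "s \<in> S \<Longrightarrow> 0 < w s"
  using w_ge_1[of s] by simp

lemma weighted_bound_nonneg:
  assumes "\<And>s. s \<in> S \<Longrightarrow> \<bar>V s\<bar> \<le> K * w s"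
  shows "0 \<le> K"
proof -
  obtain s where "s \<in> S" using S_nonempty by blast
  then have "0 \<le> K * w s" "0 < w s" using assms[of s] w_pos[of s] by auto
  then show ?thesis by (simp add: zero_le_mult_iff)
qed

text \<open>The source of the contraction factor \<open>\<gamma> * \<kappa>\<close>: one transition
  multiplies the weight by at most \<open>\<kappa>\<close>, and discounting contributes
  \<open>\<gamma>\<close>. Scaling the weight bound by \<open>K\<close> uses that \<open>K\<close>
  is nonnegative.\<close>

lemma discounted_bound:
  assumes "s \<in> S" "a \<in> A" and V: "\<And>s. s \<in> S \<Longrightarrow> \<bar>V s\<bar> \<le> K * w s"
  shows "\<gamma> * \<bar>V (g s a (xi j))\<bar> \<le> \<gamma> * \<kappa> * K * w s"
proof -
  have "\<bar>V (g s a (xi j))\<bar> \<le> K * w (g s a (xi j))"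
    using assms g_mem by blast
  also have "\<dots> \<le> K * (\<kappa> * w s)"
    using weighted_bound_nonneg[of V K] V assms g_bound by (intro mult_left_mono) auto
  finally have "\<gamma> * \<bar>V (g s a (xi j))\<bar> \<le> \<gamma> * (K * (\<kappa> * w s))"
    using gamma_nonneg by (rule mult_left_mono)
  then show ?thesis by (simp add: mult_ac)
qed

lemma integrand_bound:
  assumes "s \<in> S" "a \<in> A" and V: "\<And>s. s \<in> S \<Longrightarrow> \<bar>V s\<bar> \<le> K * w s"
  shows "\<bar>C s a (xi j) + \<gamma> * V (g s a (xi j))\<bar> \<le> (B + \<gamma> * \<kappa> * K) * w s"
proof -
  have "\<bar>C s a (xi j) + \<gamma> * V (g s a (xi j))\<bar> \<le> \<bar>C s a (xi j)\<bar> + \<gamma> * \<bar>V (g s a (xi j))\<bar>"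
    using gamma_nonneg by (metis abs_mult abs_of_nonneg abs_triangle_ineq)
  then show ?thesis
    using C_bound[OF assms(1,2), of j] discounted_bound[OF assms, of j] by (simp add: algebra_simps)
qed

lemma value_space_iff_bound:
  "V \<in> value_space S w \<longleftrightarrow> V \<in> extensional S \<and> (\<exists>K. \<forall>s\<in>S. \<bar>V s\<bar> \<le> K * w s)"
  using S_nonempty w_ge_1 by (rule value_space_iff)

text \<open>Applied with \<open>\<delta> = 0\<close> this is uniqueness of the fixed point of a contraction, with
  \<open>\<delta> > 0\<close> its stability under perturbation of the operator.\<close>
lemma weighted_contraction_bound:
  assumes K: "\<And>s. s \<in> S \<Longrightarrow> \<bar>U s\<bar> \<le> K * w s"
    and step: "\<And>D s. (\<And>s. s \<in> S \<Longrightarrow> \<bar>U s\<bar> \<le> D * w s) \<Longrightarrow> s \<in> S \<Longrightarrow> \<bar>U s\<bar> \<le> (\<gamma> * \<kappa> * D + \<delta>) * w s"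
    and s: "s \<in> S"
  shows "\<bar>U s\<bar> \<le> \<delta> / (1 - \<gamma> * \<kappa>) * w s"
proof -
  \<comment> \<open>\<open>D\<close> is the weighted norm of \<open>U\<close>, finite by the a
    priori bound \<open>K\<close>. Being itself an admissible bound, it satisfies
    \<open>D \<le> \<gamma> * \<kappa> * D + \<delta>\<close>, which is then solved for
    \<open>D\<close>.\<close>
  define D where "D = (SUP s\<in>S. \<bar>U s\<bar> / w s)"
  have bdd: "bdd_above ((\<lambda>s. \<bar>U s\<bar> / w s) ` S)"
    using K w_pos by (intro bdd_aboveI2[of _ _ K]) (auto simp: pos_divide_le_eq)
  have D: "\<bar>U s\<bar> \<le> D * w s" if "s \<in> S" for s
    using cSUP_upper[OF that bdd] w_pos[OF that] by (simp add: D_def pos_divide_le_eq)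
  have "D \<le> \<gamma> * \<kappa> * D + \<delta>"
    unfolding D_def
    by (rule cSUP_least[OF S_nonempty]) (use step[OF D] w_pos in \<open>simp add: pos_divide_le_eq D_def\<close>)
  then have "D \<le> \<delta> / (1 - \<gamma> * \<kappa>)"
    using contraction by (simp add: pos_le_divide_eq algebra_simps)
  then have "D * w s \<le> \<delta> / (1 - \<gamma> * \<kappa>) * w s"
    using w_pos[OF s] by (intro mult_right_mono) auto
  with D[OF s] show ?thesis by linarith
qed

text \<open>The change of the objective is at most the largest change among the finitely many
  integrands. Their sum dominates this maximum and tends to 0 by continuity of each
  integrand.\<close>

lemma continuous_on_obj:
  assumes Q: "Q \<noteq> {}" "Q \<subseteq> prob_vectors" and V: "continuous_on S V"
  shows "continuous_on (S \<times> A) (\<lambda>(s, a). obj Q V s a)"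
proof -
  define f where "f j z = C (fst z) (snd z) (xi j) + \<gamma> * V (g (fst z) (snd z) (xi j))" for j z
  have f: "continuous_on (S \<times> A) (f j)" for j
  proof -
    have "continuous_on (S \<times> A) (\<lambda>z. V (g (fst z) (snd z) (xi j)))"
      by (rule continuous_on_compose2[OF V]) (use g_cont[of j] g_mem in \<open>auto simp: case_prod_unfold\<close>)
    then show ?thesis
      unfolding f_def using C_cont[of j] by (intro continuous_intros) (auto simp: case_prod_unfold)
  qed
  show ?thesis
    unfolding continuous_on_def
  proof
    fix z0 assume z0: "z0 \<in> S \<times> A"
    have "((\<lambda>z. \<Sum>j\<in>UNIV. \<bar>f j z - f j z0\<bar>) \<longlongrightarrow> (\<Sum>j\<in>UNIV. \<bar>f j z0 - f j z0\<bar>)) (at z0 within S \<times> A)"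
      using f z0 by (intro tendsto_intros) (auto simp: continuous_on_def)
    then have lim: "((\<lambda>z. \<Sum>j\<in>UNIV. \<bar>f j z - f j z0\<bar>) \<longlongrightarrow> 0) (at z0 within S \<times> A)"
      by simp
    have le: "norm ((case z of (s, a) \<Rightarrow> obj Q V s a) - (case z0 of (s, a) \<Rightarrow> obj Q V s a))
      \<le> (\<Sum>j\<in>UNIV. \<bar>f j z - f j z0\<bar>)" for z
      unfolding case_prod_unfold real_norm_def
    proof (rule abs_robust_obj_diff_le[OF Q])
      fix j
      have "\<bar>f j z - f j z0\<bar> \<le> (\<Sum>j\<in>UNIV. \<bar>f j z - f j z0\<bar>)"
        by (rule member_le_sum) auto
      then show "\<bar>C (fst z) (snd z) (xi j) + \<gamma> * V (g (fst z) (snd z) (xi j)) -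
          (C (fst z0) (snd z0) (xi j) + \<gamma> * V (g (fst z0) (snd z0) (xi j)))\<bar>
          \<le> (\<Sum>j\<in>UNIV. \<bar>f j z - f j z0\<bar>)"
        by (simp add: f_def)
    qed
    show "((\<lambda>(s, a). obj Q V s a) \<longlongrightarrow> (case z0 of (s, a) \<Rightarrow> obj Q V s a)) (at z0 within S \<times> A)"
      by (rule LIM_zero_cancel, rule tendsto_0_le[OF lim, of _ 1]) (use le in \<open>auto intro!: always_eventually\<close>)
  qed
qed

section \<open>The Bellman operator of one ambiguity set and its fixed point\<close>

context
  fixes Q :: "(real ^ 'j) set"
  assumes Q: "Q \<noteq> {}" "Q \<subseteq> prob_vectors"
begin

lemma obj_bound:
  assumes "s \<in> S" "a \<in> A" and V: "\<And>s. s \<in> S \<Longrightarrow> \<bar>V s\<bar> \<le> K * w s"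
  shows "\<bar>obj Q V s a\<bar> \<le> (B + \<gamma> * \<kappa> * K) * w s"
proof -
  have exp: "\<bar>expect xi p (\<lambda>x. C s a x + \<gamma> * V (g s a x))\<bar> \<le> (B + \<gamma> * \<kappa> * K) * w s" if "p \<in> Q" for p
    using that Q(2) integrand_bound[OF assms] by (intro abs_expect_le) auto
  show ?thesis
    unfolding robust_obj_def using Q(1) exp
    by (intro cSup_abs_le) auto
qed

lemma obj_contraction:
  assumes sa: "s \<in> S" "a \<in> A" and D: "\<And>s. s \<in> S \<Longrightarrow> \<bar>V s - W s\<bar> \<le> D * w s"
  shows "\<bar>obj Q V s a - obj Q W s a\<bar> \<le> \<gamma> * \<kappa> * D * w s"
proof (rule abs_robust_obj_diff_le[OF Q])
  fix j
  show "\<bar>C s a (xi j) + \<gamma> * V (g s a (xi j)) - (C s a (xi j) + \<gamma> * W (g s a (xi j)))\<bar> \<le> \<gamma> * \<kappa> * D * w s"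
    using discounted_bound[OF sa D, of j] gamma_nonneg
    by (simp add: abs_mult flip: right_diff_distrib)
qed

lemma bdd_below_obj:
  assumes "s \<in> S" "\<And>s. s \<in> S \<Longrightarrow> \<bar>V s\<bar> \<le> K * w s"
  shows "bdd_below (obj Q V s ` A)"
proof (rule bdd_belowI2)
  fix a assume "a \<in> A"
  from obj_bound[OF assms(1) this assms(2)]
  show "- ((B + \<gamma> * \<kappa> * K) * w s) \<le> obj Q V s a" by simp
qed

lemma bellman_bound:
  assumes s: "s \<in> S" and V: "\<And>s. s \<in> S \<Longrightarrow> \<bar>V s\<bar> \<le> K * w s"
  shows "\<bar>bellman S A (obj Q) V s\<bar> \<le> (B + \<gamma> * \<kappa> * K) * w s"
  using s A_nonempty obj_bound[OF s _ V] unfolding bellman_def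
  by (auto intro!: cInf_abs_ge)

text \<open>The factor comes from \<open>obj_contraction\<close>; the constants \<open>K\<close> and
  \<open>L\<close> bound the objectives below, so that both infima are genuine.\<close>

lemma bellman_contraction:
  assumes s: "s \<in> S" and V: "\<And>s. s \<in> S \<Longrightarrow> \<bar>V s\<bar> \<le> K * w s" and W: "\<And>s. s \<in> S \<Longrightarrow> \<bar>W s\<bar> \<le> L * w s"
    and D: "\<And>s. s \<in> S \<Longrightarrow> \<bar>V s - W s\<bar> \<le> D * w s"
  shows "\<bar>bellman S A (obj Q) V s - bellman S A (obj Q) W s\<bar> \<le> \<gamma> * \<kappa> * D * w s"
  using s A_nonempty obj_contraction[OF s _ D] bdd_below_obj[OF s V] bdd_below_obj[OF s W]
  by (auto simp: bellman_def intro!: abs_cINF_diff_le)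

lemma continuous_on_bellman:
  assumes V: "\<And>s. s \<in> S \<Longrightarrow> \<bar>V s\<bar> \<le> K * w s" and cont: "continuous_on S V"
  shows "continuous_on S (bellman S A (obj Q) V)"
proof -
  have "continuous_on S (\<lambda>s. INF a\<in>A. obj Q V s a)"
    by (intro continuous_on_INF_compact continuous_on_obj Q cont A_compact A_nonempty bdd_below_obj[OF _ V])
  then show ?thesis
    by (rule continuous_on_eq) (simp add: bellman_def)
qed

text \<open>Value iteration from 0: successive iterates differ by a geometric term times the weight,
  so the iterates divided by \<open>w\<close> converge uniformly. The uniform limit inherits
  continuity, and contraction carries the fixed-point equation to it.\<close>

lemma fixed_point_exists:
  obtains V K where "V \<in> extensional S" "\<And>s. s \<in> S \<Longrightarrow> \<bar>V s\<bar> \<le> K * w s" "continuous_on S V"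
    "bellman S A (obj Q) V = V"
proof -
  define T where "T = bellman S A (obj Q)"
  define \<beta> where "\<beta> = \<gamma> * \<kappa>"
  have \<beta>: "0 \<le> \<beta>" "\<beta> < 1"
    using gamma_nonneg kappa_nonneg contraction by (auto simp: \<beta>_def)
  define v where "v n = (T ^^ n) (\<lambda>s. 0)" for n
  have v_Suc: "v (Suc n) = T (v n)" for n
    by (simp add: v_def)
  \<comment> \<open>The constant \<open>B / (1 - \<beta>)\<close> solves
    \<open>K = B + \<beta> * K\<close>, so the bound reproduces itself under
    \<open>T\<close>.\<close>
  have v: "(\<forall>s\<in>S. \<bar>v n s\<bar> \<le> B / (1 - \<beta>) * w s) \<and> continuous_on S (v n)" for n
  proof (induction n)
    case 0
    show ?case using \<beta> B_nonneg w_pos by (auto simp: v_def less_imp_le)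
  next
    case (Suc n)
    then have bd: "\<And>s. s \<in> S \<Longrightarrow> \<bar>v n s\<bar> \<le> B / (1 - \<beta>) * w s" by blast
    have "B + \<gamma> * \<kappa> * (B / (1 - \<beta>)) = B / (1 - \<beta>)"
      using \<beta> by (simp add: \<beta>_def[symmetric] field_simps)
    then show ?case
      using bellman_bound[OF _ bd] continuous_on_bellman[OF bd] Suc
      by (simp add: v_Suc T_def)
  qed
  then have vb: "\<And>n s. s \<in> S \<Longrightarrow> \<bar>v n s\<bar> \<le> B / (1 - \<beta>) * w s" by blast
  have diff: "\<forall>s\<in>S. \<bar>v (Suc n) s - v n s\<bar> \<le> B * \<beta> ^ n * w s" for n
  proof (induction n)
    case 0
    have "\<bar>T (\<lambda>s. 0) s\<bar> \<le> (B + \<gamma> * \<kappa> * 0) * w s" if "s \<in> S" for s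
      unfolding T_def using that by (intro bellman_bound) auto
    then show ?case by (simp add: v_def)
  next
    case (Suc n)
    then have "\<bar>T (v (Suc n)) s - T (v n) s\<bar> \<le> \<gamma> * \<kappa> * (B * \<beta> ^ n) * w s" if "s \<in> S" for s
      unfolding T_def by (intro bellman_contraction[OF that vb vb]) auto
    then show ?case by (simp add: v_Suc \<beta>_def mult_ac)
  qed
  \<comment> \<open>Dividing by the weight turns the geometric bound into one free of
    \<open>s\<close>, as the Weierstrass test requires; the partial sums telescope to
    \<open>v n s / w s\<close>.\<close>
  define u where "u n s = (v (Suc n) s - v n s) / w s" for n s
  define U where "U s = (\<Sum>n. u n s)" for s
  have "uniform_limit S (\<lambda>n s. \<Sum>i<n. u i s) U sequentially"
    unfolding U_def
  proof (rule Weierstrass_m_test)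
    show "norm (u n s) \<le> B * \<beta> ^ n" if "s \<in> S" for n s
      using diff[of n] that w_pos[OF that] by (simp add: u_def pos_divide_le_eq)
    show "summable (\<lambda>n. B * \<beta> ^ n)"
      using \<beta> by (intro summable_mult summable_geometric) auto
  qed
  moreover have "(\<Sum>i<n. u i s) = v n s / w s" for n s
    unfolding u_def by (induction n) (auto simp: v_def diff_divide_distrib)
  ultimately have lim: "uniform_limit S (\<lambda>n s. v n s / w s) U sequentially"
    by simp
  \<comment> \<open>The restriction to \<open>S\<close> puts \<open>V\<close> into
    \<open>extensional S\<close>.\<close>
  define V where "V = (\<lambda>s\<in>S. U s * w s)"
  have "continuous_on S (\<lambda>s. v n s / w s)" for n
    using v[of n] w_cont w_pos by (intro continuous_on_divide) (auto simp: less_imp_neq[THEN not_sym])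
  then have "continuous_on S U"
    by (intro uniform_limit_theorem[OF _ lim]) auto
  then have "continuous_on S (\<lambda>s. U s * w s)"
    using w_cont by (intro continuous_intros)
  then have Vcont: "continuous_on S V"
    by (rule continuous_on_eq) (simp add: V_def)
  have close: "\<forall>\<^sub>F n in sequentially. \<forall>s\<in>S. \<bar>v n s - V s\<bar> \<le> e * w s" if "e > 0" for e
    using uniform_limitD[OF lim that]
  proof eventually_elim
    case (elim n)
    have "\<bar>v n s - V s\<bar> \<le> e * w s" if "s \<in> S" for s
    proof -
      have "\<bar>v n s - V s\<bar> / w s = \<bar>v n s / w s - U s\<bar>"
        using w_pos[OF that] that by (simp add: V_def abs_div_pos diff_divide_distrib)
      also have "\<dots> < e"
        using elim that by (auto simp: dist_real_def)
      finally show ?thesis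
        using w_pos[OF that] by (simp add: pos_divide_less_eq)
    qed
    then show ?case by blast
  qed
  obtain n1 where n1: "\<And>s. s \<in> S \<Longrightarrow> \<bar>v n1 s - V s\<bar> \<le> 1 * w s"
    using eventually_happens'[OF sequentially_bot close[of 1]] by auto
  have Vb: "\<bar>V s\<bar> \<le> (B / (1 - \<beta>) + 1) * w s" if "s \<in> S" for s
    using n1[OF that] vb[OF that, of n1] by (simp add: distrib_right)
  have "T V s = V s" if s: "s \<in> S" for s
  proof -
    have "\<bar>T V s - V s\<bar> \<le> 0"
    proof (rule field_le_epsilon)
      fix r :: real assume "0 < r"
      \<comment> \<open>Both \<open>T (v N)\<close> versus \<open>T V\<close> and
        \<open>v (Suc N)\<close> versus \<open>V\<close> differ by at most \<open>e * w s\<close> at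
        \<open>s\<close>; the choice of \<open>e\<close> makes the total \<open>r\<close>.\<close>
      define e where "e = r / (2 * w s)"
      have e: "e > 0" using \<open>0 < r\<close> w_pos[OF s] by (simp add: e_def)
      from close[OF e] obtain N where N: "\<And>n s. n \<ge> N \<Longrightarrow> s \<in> S \<Longrightarrow> \<bar>v n s - V s\<bar> \<le> e * w s"
        unfolding eventually_sequentially by blast
      have "\<bar>T (v N) s - T V s\<bar> \<le> \<gamma> * \<kappa> * e * w s"
        unfolding T_def by (intro bellman_contraction[OF s vb Vb] N) auto
      also have "\<dots> \<le> 1 * e * w s"
        using contraction e w_pos[OF s] by (intro mult_right_mono) auto
      finally have "\<bar>T V s - V s\<bar> \<le> 2 * (e * w s)"
        using N[of "Suc N" s] s by (simp add: v_Suc)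
      also have "2 * (e * w s) = r"
        using w_pos[OF s] by (simp add: e_def)
      finally show "\<bar>T V s - V s\<bar> \<le> 0 + r" by simp
    qed
    then show ?thesis by simp
  qed
  then have "bellman S A (obj Q) V = V"
    by (intro extensionalityI[of _ S]) (auto simp: T_def bellman_def V_def)
  moreover have "V \<in> extensional S"
    by (simp add: V_def)
  ultimately show ?thesis
    using that Vb Vcont by blast
qed

lemma fixed_point_unique:
  assumes "V \<in> value_space S w" "W \<in> value_space S w"
    and fp: "bellman S A (obj Q) V = V" "bellman S A (obj Q) W = W"
  shows "V = W"
proof -
  obtain K L where K: "\<And>s. s \<in> S \<Longrightarrow> \<bar>V s\<bar> \<le> K * w s" and L: "\<And>s. s \<in> S \<Longrightarrow> \<bar>W s\<bar> \<le> L * w s"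
    and ext: "V \<in> extensional S" "W \<in> extensional S"
    using assms(1,2) unfolding value_space_iff_bound by blast
  have "\<bar>V s - W s\<bar> \<le> 0 / (1 - \<gamma> * \<kappa>) * w s" if "s \<in> S" for s
  proof (rule weighted_contraction_bound[OF _ _ that])
    show "\<bar>V s - W s\<bar> \<le> (K + L) * w s" if "s \<in> S" for s
      using K[OF that] L[OF that] by (simp add: distrib_right)
    show "\<bar>V s - W s\<bar> \<le> (\<gamma> * \<kappa> * D + 0) * w s"
      if "\<And>s. s \<in> S \<Longrightarrow> \<bar>V s - W s\<bar> \<le> D * w s" "s \<in> S" for D s
      using bellman_contraction[OF that(2) K L that(1)] fp by simp
  qed
  then show ?thesis
    using ext by (intro extensionalityI[of _ S]) auto
qed

text \<open>Existence and uniqueness identify the definite description in \<open>value_fun\<close>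
  with the limit of value iteration, whose continuity and bound it thereby acquires.\<close>

lemma val_fixed_point:
  shows bellman_val: "bellman S A (obj Q) (val Q) = val Q"
    and continuous_on_val: "continuous_on S (val Q)"
    and val_bound: "\<exists>K. \<forall>s\<in>S. \<bar>val Q s\<bar> \<le> K * w s"
proof -
  from fixed_point_exists obtain V K where V: "V \<in> extensional S" "\<And>s. s \<in> S \<Longrightarrow> \<bar>V s\<bar> \<le> K * w s"
    "continuous_on S V" "bellman S A (obj Q) V = V" by blast
  then have "V \<in> value_space S w"
    unfolding value_space_iff_bound by blast
  then have eq: "val Q = V"
    unfolding value_fun_def using V(4) fixed_point_unique by (intro the_equality) auto
  show "bellman S A (obj Q) (val Q) = val Q" "continuous_on S (val Q)"
    "\<exists>K. \<forall>s\<in>S. \<bar>val Q s\<bar> \<le> K * w s"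
    using V unfolding eq by blast+
qed

lemma continuous_on_obj_val:
  assumes "s \<in> S"
  shows "continuous_on A (obj Q (val Q) s)"
proof -
  have "continuous_on A ((\<lambda>(s, a). obj Q (val Q) s a) \<circ> Pair s)"
    using assms
    by (intro continuous_on_compose continuous_on_subset[OF continuous_on_obj[OF Q continuous_on_val]]
        continuous_intros) auto
  then show ?thesis by (simp add: o_def)
qed

lemma optimal_actions_nonempty:
  assumes "s \<in> S"
  shows "optimal_actions S A w (obj Q) s \<noteq> {}"
  unfolding optimal_actions_def
  by (intro argmin_nonempty A_compact A_nonempty continuous_on_obj_val assms)

section \<open>Dependence on the ambiguity set\<close>

text \<open>Compare both sides with \<open>obj Q W\<close>: replacing \<open>V\<close> by
  \<open>W\<close> costs the contraction term, and replacing \<open>Q\<close> by \<open>{p}\<close>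
  costs the 1-norm distance times a uniform bound on the integrand.\<close>

lemma obj_perturbation:
  assumes p: "p \<in> prob_vectors" and dist: "\<And>q. q \<in> Q \<Longrightarrow> (\<Sum>j\<in>UNIV. \<bar>q $ j - p $ j\<bar>) \<le> e"
    and W: "\<And>s. s \<in> S \<Longrightarrow> \<bar>W s\<bar> \<le> K * w s"
    and D: "\<And>s. s \<in> S \<Longrightarrow> \<bar>V s - W s\<bar> \<le> D * w s"
    and sa: "s \<in> S" "a \<in> A"
  shows "\<bar>obj Q V s a - obj {p} W s a\<bar> \<le> (\<gamma> * \<kappa> * D + e * (B + \<gamma> * \<kappa> * K)) * w s"
proof -
  define f where "f x = C s a x + \<gamma> * W (g s a x)" for x
  define G where "G = (B + \<gamma> * \<kappa> * K) * w s"
  have f: "\<bar>f (xi j)\<bar> \<le> G" for j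
    unfolding f_def G_def by (rule integrand_bound[OF sa W])
  have G: "0 \<le> G"
    using f order_trans[OF abs_ge_zero] by blast
  have "\<bar>expect xi q f - expect xi p f\<bar> \<le> e * G" if "q \<in> Q" for q
  proof -
    have "\<bar>expect xi q f - expect xi p f\<bar> = \<bar>\<Sum>j\<in>UNIV. (q $ j - p $ j) * f (xi j)\<bar>"
      by (simp add: expect_def left_diff_distrib sum_subtractf)
    also have "\<dots> \<le> (\<Sum>j\<in>UNIV. \<bar>(q $ j - p $ j) * f (xi j)\<bar>)"
      by (rule sum_abs)
    also have "\<dots> \<le> (\<Sum>j\<in>UNIV. \<bar>q $ j - p $ j\<bar> * G)"
      by (intro sum_mono) (simp add: abs_mult f mult_left_mono)
    also have "\<dots> = (\<Sum>j\<in>UNIV. \<bar>q $ j - p $ j\<bar>) * G"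
      by (simp add: sum_distrib_right)
    also have "\<dots> \<le> e * G"
      using dist[OF that] G by (rule mult_right_mono)
    finally show ?thesis .
  qed
  \<comment> \<open>The nominal expectation is written as a supremum of a constant over
    \<open>Q\<close>, so that the two suprema can be compared term by term.\<close>
  then have "\<bar>(SUP q\<in>Q. expect xi q f) - (SUP q\<in>Q. expect xi p f)\<bar> \<le> e * G"
    using Q p by (intro abs_cSUP_diff_le bdd_above_expect) auto
  then have "\<bar>obj Q W s a - obj {p} W s a\<bar> \<le> e * G"
    using Q(1) by (simp add: robust_obj_def f_def[abs_def])
  with obj_contraction[OF sa D] show ?thesis
    by (simp add: G_def algebra_simps abs_le_iff)
qed

end

text \<open>The objectives differ also through their value functions, so that gap is bounded first:
  comparing the two Bellman equations gives a self-referential estimate, closed by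
  \<open>weighted_contraction_bound\<close>. Since \<open>K\<close> bounds the value function of
  \<open>{p}\<close>, the constant does not depend on \<open>Q\<close>.\<close>

lemma obj_val_perturbation:
  assumes Q: "Q \<noteq> {}" "Q \<subseteq> prob_vectors" and p: "p \<in> prob_vectors"
    and dist: "\<And>q. q \<in> Q \<Longrightarrow> (\<Sum>j\<in>UNIV. \<bar>q $ j - p $ j\<bar>) \<le> e"
    and K: "\<And>s. s \<in> S \<Longrightarrow> \<bar>val {p} s\<bar> \<le> K * w s"
    and sa: "s \<in> S" "a \<in> A"
  shows "\<bar>obj Q (val Q) s a - obj {p} (val {p}) s a\<bar> \<le> e * (B + \<gamma> * \<kappa> * K) / (1 - \<gamma> * \<kappa>) * w s"
proof -
  let ?V = "val Q" and ?W = "val {p}" and ?d = "e * (B + \<gamma> * \<kappa> * K)"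
  have P: "{p} \<noteq> {}" "{p} \<subseteq> prob_vectors" using p by auto
  obtain L where L: "\<And>s. s \<in> S \<Longrightarrow> \<bar>?V s\<bar> \<le> L * w s"
    using val_bound[OF Q] by blast
  have pert: "\<bar>obj Q ?V s a - obj {p} ?W s a\<bar> \<le> (\<gamma> * \<kappa> * D + ?d) * w s"
    if "\<And>s. s \<in> S \<Longrightarrow> \<bar>?V s - ?W s\<bar> \<le> D * w s" "s \<in> S" "a \<in> A" for D s a
    by (rule obj_perturbation[OF Q p dist K that])
  have "\<bar>?V s - ?W s\<bar> \<le> ?d / (1 - \<gamma> * \<kappa>) * w s" if "s \<in> S" for s
  proof (rule weighted_contraction_bound[OF _ _ that])
    show "\<bar>?V s - ?W s\<bar> \<le> (L + K) * w s" if "s \<in> S" for s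
      using K[OF that] L[OF that] by (simp add: distrib_right)
  next
    fix D s assume D: "\<And>s. s \<in> S \<Longrightarrow> \<bar>?V s - ?W s\<bar> \<le> D * w s" and s: "s \<in> S"
    have "\<bar>(INF a\<in>A. obj Q ?V s a) - (INF a\<in>A. obj {p} ?W s a)\<bar> \<le> (\<gamma> * \<kappa> * D + ?d) * w s"
      using A_nonempty bdd_below_obj[OF Q s L] bdd_below_obj[OF P s K] pert[OF D s] by (intro abs_cINF_diff_le) auto
    moreover have "?V s = (INF a\<in>A. obj Q ?V s a)" "?W s = (INF a\<in>A. obj {p} ?W s a)"
      using fun_cong[OF bellman_val[OF Q], of s] fun_cong[OF bellman_val[OF P], of s] s
      by (simp_all add: bellman_def)
    ultimately show "\<bar>?V s - ?W s\<bar> \<le> (\<gamma> * \<kappa> * D + ?d) * w s" by simp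
  qed
  \<comment> \<open>The bound on the value functions enters with
    \<open>D = ?d / (1 - \<gamma> * \<kappa>)\<close>, which is a fixed point of the map from
    \<open>D\<close> to \<open>\<gamma> * \<kappa> * D + ?d\<close>.\<close>
  from pert[OF this sa] have "\<bar>obj Q ?V s a - obj {p} ?W s a\<bar>
      \<le> (\<gamma> * \<kappa> * (?d / (1 - \<gamma> * \<kappa>)) + ?d) * w s" .
  also have "\<gamma> * \<kappa> * (?d / (1 - \<gamma> * \<kappa>)) + ?d = ?d / (1 - \<gamma> * \<kappa>)"
    using contraction by (simp add: field_simps)
  finally show ?thesis .
qed

text \<open>At a fixed state the perturbation bound is a constant times \<open>e n\<close>, the same
  for all actions; the objectives thus converge uniformly on \<open>A\<close>, and stability of
  minimizers applies.\<close>

theorem infdist_optimal_actions_tendsto: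
  assumes Q: "\<And>n. Q n \<noteq> {}" "\<And>n. Q n \<subseteq> prob_vectors" and p: "p \<in> prob_vectors"
    and dist: "\<And>n q. q \<in> Q n \<Longrightarrow> (\<Sum>j\<in>UNIV. \<bar>q $ j - p $ j\<bar>) \<le> e n" and e: "e \<longlonglongrightarrow> 0"
    and s: "s \<in> S" and x: "\<And>n. x n \<in> optimal_actions S A w (obj (Q n)) s"
  shows "(\<lambda>n. infdist (x n) (optimal_actions S A w (obj {p}) s)) \<longlonglongrightarrow> 0"
proof -
  have P: "{p} \<noteq> {}" "{p} \<subseteq> prob_vectors" using p by auto
  obtain K where K: "\<And>s. s \<in> S \<Longrightarrow> \<bar>val {p} s\<bar> \<le> K * w s"
    using val_bound[OF P] by blast
  define d where "d n = e n * (B + \<gamma> * \<kappa> * K) / (1 - \<gamma> * \<kappa>) * w s" for n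
  have d_eq: "d = (\<lambda>n. e n * ((B + \<gamma> * \<kappa> * K) / (1 - \<gamma> * \<kappa>) * w s))"
    by (simp add: fun_eq_iff d_def)
  have d: "d \<longlonglongrightarrow> 0"
    unfolding d_eq using e by (rule tendsto_mult_left_zero)
  have close: "\<bar>obj (Q n) (val (Q n)) s a - obj {p} (val {p}) s a\<bar> \<le> d n" if "a \<in> A" for n a
    unfolding d_def by (rule obj_val_perturbation[OF Q p dist K s that])
  show ?thesis
    using x unfolding optimal_actions_def
    by (intro infdist_argmin_tendsto[OF A_compact continuous_on_obj_val[OF P s] close d]) auto
qed

end

subsection \<open>Consistency of the optimal actions\<close>

theorem theorem3:
  fixes S :: "(real ^ 'm) set" and A :: "(real ^ 'n) set"
    and xi :: "'j::finite \<Rightarrow> real ^ 'k"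
    and C :: "real ^ 'm \<Rightarrow> real ^ 'n \<Rightarrow> real ^ 'k \<Rightarrow> real"
    and g :: "real ^ 'm \<Rightarrow> real ^ 'n \<Rightarrow> real ^ 'k \<Rightarrow> real ^ 'm"
    and \<gamma> \<alpha> C_bar \<kappa> :: real
    and Pc :: "real ^ 'j" and tau0 :: "'j \<Rightarrow> real"
    and w :: "real ^ 'm \<Rightarrow> real"
    and M :: "'w measure" and X :: "nat \<Rightarrow> 'w \<Rightarrow> real ^ 'k"
    and s_bar :: "real ^ 'm"
  assumes S: "S \<noteq> {}" "closed S"
    and A: "A \<noteq> {}" "closed A"
    and xi: "inj xi"
    and g_range: "\<And>s a j. s \<in> S \<Longrightarrow> a \<in> A \<Longrightarrow> g s a (xi j) \<in> S"
    and gamma: "0 \<le> \<gamma>" "\<gamma> < 1"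
    and Pc: "Pc \<in> prob_vectors"
    and tau0: "\<And>j. tau0 j > 1"
    and alpha: "0 < \<alpha>" "\<alpha> < 1"
    and M: "prob_space M"
    and X: "iid_sample M X xi Pc"
    and w: "continuous_on S w" "\<And>s. s \<in> S \<Longrightarrow> w s \<ge> 1"
    and A_compact: "compact A"
    and C_cont: "\<And>j. continuous_on (S \<times> A) (\<lambda>(s, a). C s a (xi j))"
    and g_cont: "\<And>j. continuous_on (S \<times> A) (\<lambda>(s, a). g s a (xi j))"
    and C_bar: "C_bar > 0"
    and kappa: "\<kappa> \<ge> 0"
    and C_bound: "\<And>s a j. s \<in> S \<Longrightarrow> a \<in> A \<Longrightarrow> \<bar>C s a (xi j)\<bar> \<le> C_bar * w s"
    and g_bound: "\<And>s a j. s \<in> S \<Longrightarrow> a \<in> A \<Longrightarrow> w (g s a (xi j)) \<le> \<kappa> * w s"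
    and gamma_kappa: "\<gamma> * \<kappa> < 1"
    and s_bar: "s_bar \<in> S"
  shows "(\<forall>N. \<forall>\<omega>\<in>space M. bayes_optimal_actions S A w xi C g \<gamma> tau0 \<alpha> X N \<omega> s_bar \<noteq> {})
    \<and> true_optimal_actions S A w xi C g \<gamma> Pc s_bar \<noteq> {}
    \<and> (\<forall>pi_hat :: nat \<Rightarrow> 'w \<Rightarrow> real ^ 'n.
         (\<forall>N. \<forall>\<omega>\<in>space M.
            pi_hat N \<omega> \<in> bayes_optimal_actions S A w xi C g \<gamma> tau0 \<alpha> X N \<omega> s_bar)
         \<longrightarrow> (AE \<omega> in M. (\<lambda>N. infdist (pi_hat N \<omega>)
                              (true_optimal_actions S A w xi C g \<gamma> Pc s_bar)) \<longlonglongrightarrow> 0)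
           \<and> (\<forall>pi_star. true_optimal_actions S A w xi C g \<gamma> Pc s_bar = {pi_star}
                \<longrightarrow> (AE \<omega> in M. (\<lambda>N. pi_hat N \<omega>) \<longlonglongrightarrow> pi_star)))"
proof -
  interpret weighted_control S A xi C g \<gamma> w C_bar \<kappa>
    by unfold_locales
      (use S A_compact A g_range gamma kappa C_bar gamma_kappa w C_cont g_cont C_bound g_bound in auto)
  interpret prob_space M by (rule M)
  let ?Q = "bayes_ambiguity_set xi tau0 \<alpha> X"
  let ?p = "\<lambda>N \<omega>. p_hat xi tau0 X N \<omega>" and ?r = "\<lambda>N \<omega>. r_hat xi tau0 \<alpha> X N \<omega>"
  let ?bayes = "bayes_optimal_actions S A w xi C g \<gamma> tau0 \<alpha> X"
  let ?true = "true_optimal_actions S A w xi C g \<gamma> Pc"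
  have bayes: "?bayes N \<omega> = optimal_actions S A w (obj (?Q N \<omega>))" for N \<omega>
    by (simp add: bayes_optimal_actions_def)
  have true_eq: "?true = optimal_actions S A w (obj {Pc})"
    by (simp add: true_optimal_actions_def nominal_obj_eq_robust_obj)
  have Q: "?Q N \<omega> \<noteq> {}" "?Q N \<omega> \<subseteq> prob_vectors" for N \<omega>
    using bayes_ambiguity_set_nonempty[of tau0 \<alpha> xi X N \<omega>] tau0 alpha
    by (auto simp: bayes_ambiguity_set_def ambiguity_set_def)
  have freq: "AE \<omega> in M. (\<lambda>N. (\<Sum>i=1..N. of_bool (X i \<omega> = xi j)) / real N) \<longlonglongrightarrow> Pc $ j" for j
    using X by (intro AE_empirical_frequency_tendsto) (auto simp: iid_sample_def)
  then have AE_freq: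
    "AE \<omega> in M. \<forall>j. (\<lambda>N. (\<Sum>i=1..N. of_bool (X i \<omega> = xi j)) / real N) \<longlonglongrightarrow> Pc $ j"
    by (subst AE_all_countable) auto
  \<comment> \<open>The exceptional null set comes from the frequencies alone, so it serves every
    selection \<open>pi_hat\<close>.\<close>
  have lim: "AE \<omega> in M. (\<lambda>N. infdist (pi_hat N \<omega>) (?true s_bar)) \<longlonglongrightarrow> 0"
    if pi_hat: "\<forall>N. \<forall>\<omega>\<in>space M. pi_hat N \<omega> \<in> ?bayes N \<omega> s_bar" for pi_hat :: "nat \<Rightarrow> 'w \<Rightarrow> real ^ 'n"
    using AE_freq AE_space
  proof eventually_elim
    case (elim \<omega>)
    \<comment> \<open>Radius plus error of the center, summed over the coordinates: by the triangle
      inequality this dominates the 1-norm distance of any member of the ambiguity set to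
      \<open>Pc\<close>.\<close>
    define e where "e N = (\<Sum>j\<in>UNIV. ?r N \<omega> $ j + \<bar>?p N \<omega> $ j - Pc $ j\<bar>)" for N
    have sum_Pc: "(\<Sum>j\<in>UNIV. Pc $ j) = 1"
      using Pc by (simp add: prob_vectors_def)
    have "e \<longlonglongrightarrow> (\<Sum>j\<in>(UNIV :: 'j set). 0 + \<bar>Pc $ j - Pc $ j\<bar>)"
      unfolding e_def
      by (intro tendsto_sum tendsto_add tendsto_rabs tendsto_diff tendsto_const
          p_hat_tendsto r_hat_tendsto[where p = Pc] sum_Pc elim(1)[rule_format])
    then have e: "e \<longlonglongrightarrow> 0" by simp
    have "(\<Sum>j\<in>UNIV. \<bar>q $ j - Pc $ j\<bar>) \<le> e N" if "q \<in> ?Q N \<omega>" for N q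
      unfolding e_def
    proof (rule sum_mono)
      fix j
      have "\<bar>q $ j - ?p N \<omega> $ j\<bar> \<le> ?r N \<omega> $ j"
        using that unfolding bayes_ambiguity_set_def ambiguity_set_def abs_le_iff
        by (auto simp: algebra_simps)
      then show "\<bar>q $ j - Pc $ j\<bar> \<le> ?r N \<omega> $ j + \<bar>?p N \<omega> $ j - Pc $ j\<bar>"
        by linarith
    qed
    then show ?case
      unfolding true_eq using pi_hat elim(2)
      by (intro infdist_optimal_actions_tendsto[OF Q Pc _ e s_bar]) (auto simp: bayes)
  qed
  have "AE \<omega> in M. (\<lambda>N. pi_hat N \<omega>) \<longlonglongrightarrow> pi_star"
    if "\<forall>N. \<forall>\<omega>\<in>space M. pi_hat N \<omega> \<in> ?bayes N \<omega> s_bar" "?true s_bar = {pi_star}"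
    for pi_hat :: "nat \<Rightarrow> 'w \<Rightarrow> real ^ 'n" and pi_star
    using lim[OF that(1)] unfolding that(2) infdist_singleton tendsto_dist_iff[symmetric] .
  moreover have "?bayes N \<omega> s_bar \<noteq> {}" for N \<omega>
    unfolding bayes by (rule optimal_actions_nonempty[OF Q s_bar])
  \<comment> \<open>\<open>infdist\<close> to the empty set is 0 by convention; nonemptiness makes
    the convergence of distances a genuine statement.\<close>
  moreover have "?true s_bar \<noteq> {}"
    unfolding true_eq by (rule optimal_actions_nonempty) (use Pc s_bar in auto)
  ultimately show ?thesis
    using lim by blast
qed

end
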